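(* Let $a,b\in\mathbb{C}$ with $|a|^2+|b|^2=1$, let $A=\begin{pmatrix} a & b\\ -\overline{b} & \overline{a}\end{pmatrix}$, and suppose that $a\neq 0$ and $b\neq 0$. Let $\varphi={}^{t}(\varphi_1,\varphi_2)$ be a unit vector in $\mathbb{C}^2$, and let $p_n^A(\varphi;x)$ $(x\in\mathbb{Z})$ be the transition probability at time $n$ of the quantum walk $U(A)$ with initial state $\delta_0\otimes\varphi$. Then, as $n\to\infty$, the probability measures $\sum_{x\in\mathbb{Z}}p_n^A(\varphi;x)\,\delta_{x/n}$ on $\mathbb{R}$ converge weakly to the measure $$\chi_{(-|a|,|a|)}(y)\,\frac{|b|\,(1+\lambda_A(\varphi)y)}{\pi(1-y^2)\sqrt{|a|^2-y^2}}\,dy,$$ where $$\lambda_A(\varphi)=|\varphi_1|^2-|\varphi_2|^2-\frac{1}{|a|^2}\left(ab\,\overline{\varphi}_1\varphi_2+\overline{a}\,\overline{b}\,\varphi_1\overline{\varphi}_2\right).$$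
   Context: $\ell^2(\mathbb{Z})\otimes\mathbb{C}^2$ is the Hilbert space of square summable functions $f:\mathbb{Z}\to\mathbb{C}^2$ with inner product $\langle f,g\rangle=\sum_{x\in\mathbb{Z}}\langle f(x),g(x)\rangle_{\mathbb{C}^2}$. For $u\in\mathbb{C}^2$, $x\in\mathbb{Z}$, $\delta_x\otimes u$ is the function equal to $u$ at $x$ and $0$ elsewhere. The shift operator $\tau$ is the unitary operator with $\tau(\delta_x\otimes u)=\delta_{x+1}\otimes u$. Put $P_A=\begin{pmatrix} a&0\\ -\overline{b}&0\end{pmatrix}$ and $Q_A=\begin{pmatrix}0&b\\0&\overline{a}\end{pmatrix}$, so $A=P_A+Q_A$; these matrices act pointwise on $\ell^2(\mathbb{Z})\otimes\mathbb{C}^2$. The quantum walk is the unitary operator $U(A)=P_A\tau+Q_A\tau^{-1}$ on $\ell^2(\mathbb{Z})\otimes\mathbb{C}^2$. For a positive integer $n$ and a unit vector $\varphi\in\mathbb{C}^2$, the transition probability is $p_n^A(\varphi;x)=\|U(A)^n(\delta_0\otimes\varphi)(x)\|_{\mathbb{C}^2}^2$, $x\in\mathbb{Z}$; it is a probability distribution on $\mathbb{Z}$. $\delta_{x/n}$ in the sum of measures denotes the Dirac measure at the point $x/n\in\mathbb{R}$, and $\chi_{(-|a|,|a|)}$ is the characteristic (indicator) function of the interval $(-|a|,|a|)$. Weak convergence of probability measures means convergence of integrals of all bounded continuous functions. *)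

theory Defs
  imports "HOL-Probability.Probability"
begin

text \<open>
  The Hilbert space \<open>\<ell>\<^sup>2(\<int>) \<otimes> \<complex>\<^sup>2\<close>, realised as a set of functions. The operators below are given
  by pointwise formulas and hence defined on all functions; that \<open>walk A\<close> restricts to a
  unitary operator of \<open>ell2\<close> is proved in \<open>walk_unitary\<close>.
\<close>

type_synonym state = "int \<Rightarrow> complex^2"

definition ell2 :: "state set" where
  "ell2 = {f. (\<lambda>x. (norm (f x))\<^sup>2) summable_on UNIV}"

definition ell2_inner :: "state \<Rightarrow> state \<Rightarrow> complex" where
  "ell2_inner f g = (\<Sum>\<^sub>\<infinity>x. \<Sum>i\<in>UNIV. cnj (f x $ i) * g x $ i)"

definition delta :: "int \<Rightarrow> complex^2 \<Rightarrow> state" where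
  "delta x u = (\<lambda>z. if z = x then u else 0)"

definition shift :: "state \<Rightarrow> state" where
  "shift f = (\<lambda>x. f (x - 1))"

definition mult_op :: "complex^2^2 \<Rightarrow> state \<Rightarrow> state" where
  "mult_op M f = (\<lambda>x. M *v f x)"

definition P_mat :: "complex^2^2 \<Rightarrow> complex^2^2" where
  "P_mat A = vector [vector [A$1$1, 0], vector [A$2$1, 0]]"

definition Q_mat :: "complex^2^2 \<Rightarrow> complex^2^2" where
  "Q_mat A = vector [vector [0, A$1$2], vector [0, A$2$2]]"

definition walk :: "complex^2^2 \<Rightarrow> state \<Rightarrow> state" where
  "walk A f = (\<lambda>x. mult_op (P_mat A) (shift f) x + mult_op (Q_mat A) (inv shift f) x)"

definition trans_prob :: "complex^2^2 \<Rightarrow> complex^2 \<Rightarrow> nat \<Rightarrow> int \<Rightarrow> real" where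
  "trans_prob A \<phi> n x = (norm ((walk A ^^ n) (delta 0 \<phi>) x))\<^sup>2"

text \<open>
  The measure \<open>\<Sum>\<^sub>x p\<^sub>n(\<phi>;x) \<delta>\<^bsub>x/n\<^esub>\<close> on \<open>\<real>\<close>, as the image of the measure with weights
  \<open>p\<^sub>n(\<phi>;x)\<close> on \<open>\<int>\<close>; see \<open>emeasure_walk_measure\<close>.
\<close>

definition walk_measure :: "complex^2^2 \<Rightarrow> complex^2 \<Rightarrow> nat \<Rightarrow> real measure" where
  "walk_measure A \<phi> n =
     distr (density (count_space UNIV) (\<lambda>x. ennreal (trans_prob A \<phi> n x))) borel
       (\<lambda>x. real_of_int x / real n)"

definition walk_lambda :: "complex \<Rightarrow> complex \<Rightarrow> complex^2 \<Rightarrow> real" where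
  "walk_lambda a b \<phi> = (cmod (\<phi>$1))\<^sup>2 - (cmod (\<phi>$2))\<^sup>2
     - 1 / (cmod a)\<^sup>2 * Re (a * b * cnj (\<phi>$1) * \<phi>$2 + cnj a * cnj b * \<phi>$1 * cnj (\<phi>$2))"

definition limit_density :: "complex \<Rightarrow> complex \<Rightarrow> complex^2 \<Rightarrow> real \<Rightarrow> real" where
  "limit_density a b \<phi> y = indicator {- cmod a<..<cmod a} y *
     (cmod b * (1 + walk_lambda a b \<phi> * y) / (pi * (1 - y\<^sup>2) * sqrt ((cmod a)\<^sup>2 - y\<^sup>2)))"

text \<open>
  Weak convergence through bounded continuous test functions; the library's \<open>weak_conv_m\<close>
  is instead stated through distribution functions.
\<close>

definition weakly_converges :: "(nat \<Rightarrow> real measure) \<Rightarrow> real measure \<Rightarrow> bool" where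
  "weakly_converges M N \<longleftrightarrow>
     (\<forall>f :: real \<Rightarrow> real. continuous_on UNIV f \<longrightarrow> bounded (range f) \<longrightarrow>
        (\<lambda>n. integral\<^sup>L (M n) f) \<longlonglongrightarrow> integral\<^sup>L N f)"


text \<open>The remaining facts confirm that the above are the intended objects.\<close>

lemma inv_shift: "inv shift f = (\<lambda>x. f (x + 1))"
proof -
  have "inv shift = (\<lambda>f x. f (x + 1))"
    by (rule inv_unique_comp) (auto simp: shift_def fun_eq_iff)
  thus ?thesis by simp
qed

lemma shift_delta: "shift (delta x u) = delta (x + 1) u"
  by (auto simp: shift_def delta_def fun_eq_iff)

lemma P_mat_plus_Q_mat: "P_mat A + Q_mat A = A"
  by (simp add: P_mat_def Q_mat_def vec_eq_iff forall_2)

lemma walk_lambda_complex: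
  "complex_of_real (walk_lambda a b \<phi>) = (cmod (\<phi>$1))\<^sup>2 - (cmod (\<phi>$2))\<^sup>2
     - 1 / (cmod a)\<^sup>2 * (a * b * cnj (\<phi>$1) * \<phi>$2 + cnj a * cnj b * \<phi>$1 * cnj (\<phi>$2))"
proof -
  define X where "X = a * b * cnj (\<phi>$1) * \<phi>$2 + cnj a * cnj b * \<phi>$1 * cnj (\<phi>$2)"
  have "Im X = 0" by (simp add: X_def algebra_simps)
  hence "complex_of_real (Re X) = X" by (simp add: complex_eq_iff)
  thus ?thesis by (simp add: walk_lambda_def flip: X_def)
qed

lemma delta_in_ell2: "delta x u \<in> ell2"
proof -
  have "(\<lambda>z. (norm (delta x u z))\<^sup>2) summable_on {x}"
    by simp
  hence "(\<lambda>z. (norm (delta x u z))\<^sup>2) summable_on UNIV"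
    by (rule summable_on_cong_neutral[THEN iffD1, rotated -1]) (auto simp: delta_def)
  thus ?thesis by (simp add: ell2_def)
qed

lemma norm_sq_2: "(norm (u :: complex^2))\<^sup>2 = (cmod (u$1))\<^sup>2 + (cmod (u$2))\<^sup>2"
  by (simp add: norm_vec_def L2_set_def sum_2)

lemma walk_components:
  "walk A f x $ 1 = A$1$1 * f (x - 1) $ 1 + A$1$2 * f (x + 1) $ 2"
  "walk A f x $ 2 = A$2$1 * f (x - 1) $ 1 + A$2$2 * f (x + 1) $ 2"
  by (simp_all add: walk_def mult_op_def inv_shift shift_def P_mat_def Q_mat_def
      matrix_vector_mult_def sum_2)

lemma ell2_iff:
  "f \<in> ell2 \<longleftrightarrow> (\<lambda>x. (cmod (f x $ 1))\<^sup>2) summable_on UNIV \<and> (\<lambda>x. (cmod (f x $ 2))\<^sup>2) summable_on UNIV"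
proof
  assume "f \<in> ell2"
  hence s: "(\<lambda>x. (norm (f x))\<^sup>2) summable_on UNIV" by (simp add: ell2_def)
  show "(\<lambda>x. (cmod (f x $ 1))\<^sup>2) summable_on UNIV \<and> (\<lambda>x. (cmod (f x $ 2))\<^sup>2) summable_on UNIV"
    by (intro conjI; rule summable_on_comparison_test[OF s]) (auto simp: norm_sq_2)
next
  assume "(\<lambda>x. (cmod (f x $ 1))\<^sup>2) summable_on UNIV \<and> (\<lambda>x. (cmod (f x $ 2))\<^sup>2) summable_on UNIV"
  thus "f \<in> ell2" by (simp add: ell2_def norm_sq_2 summable_on_add)
qed

lemma shift_int_summable:
  fixes F :: "int \<Rightarrow> 'a :: {comm_monoid_add, t2_space}"
  shows "(\<lambda>x. F (x + k)) summable_on UNIV \<longleftrightarrow> F summable_on UNIV"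
    and "(\<Sum>\<^sub>\<infinity>x. F (x + k)) = (\<Sum>\<^sub>\<infinity>x. F x)"
proof -
  have bij: "bij_betw (\<lambda>x :: int. x + k) UNIV UNIV"
    by (rule bij_betw_byWitness[of _ "\<lambda>x. x - k"]) auto
  show "(\<lambda>x. F (x + k)) summable_on UNIV \<longleftrightarrow> F summable_on UNIV"
    by (rule summable_on_reindex_bij_betw[OF bij])
  show "(\<Sum>\<^sub>\<infinity>x. F (x + k)) = (\<Sum>\<^sub>\<infinity>x. F x)"
    by (rule infsum_reindex_bij_betw[OF bij])
qed

lemma ell2_mult_summable:
  fixes F G :: "int \<Rightarrow> complex"
  assumes "(\<lambda>x. (cmod (F x))\<^sup>2) summable_on UNIV" "(\<lambda>x. (cmod (G x))\<^sup>2) summable_on UNIV"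
  shows "(\<lambda>x. cnj (F x) * G x) summable_on UNIV"
proof -
  have "(\<lambda>x. (cmod (F x))\<^sup>2 + (cmod (G x))\<^sup>2) summable_on UNIV"
    using assms by (rule summable_on_add)
  hence "(\<lambda>x. norm (cnj (F x) * G x)) summable_on UNIV"
  proof (rule summable_on_comparison_test)
    fix x
    have "2 * cmod (F x) * cmod (G x) \<le> (cmod (F x))\<^sup>2 + (cmod (G x))\<^sup>2"
      by (rule sum_squares_bound)
    moreover have "0 \<le> cmod (F x) * cmod (G x)" by simp
    ultimately show "norm (cnj (F x) * G x) \<le> (cmod (F x))\<^sup>2 + (cmod (G x))\<^sup>2"
      by (simp only: norm_mult complex_mod_cnj)
  qed auto
  thus ?thesis by (rule abs_summable_summable)
qed

lemma ell2_lincomb: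
  fixes F G :: "int \<Rightarrow> complex"
  assumes "(\<lambda>x. (cmod (F x))\<^sup>2) summable_on UNIV" "(\<lambda>x. (cmod (G x))\<^sup>2) summable_on UNIV"
  shows "(\<lambda>x. (cmod (c * F (x + k) + d * G (x + l)))\<^sup>2) summable_on UNIV"
proof -
  have "(\<lambda>x. 2 * (cmod c)\<^sup>2 * (cmod (F (x + k)))\<^sup>2 + 2 * (cmod d)\<^sup>2 * (cmod (G (x + l)))\<^sup>2) summable_on UNIV"
    using assms shift_int_summable(1)[of "\<lambda>x. (cmod (F x))\<^sup>2" k]
      shift_int_summable(1)[of "\<lambda>x. (cmod (G x))\<^sup>2" l]
    by (intro summable_on_add summable_on_cmult_right) auto
  thus ?thesis
  proof (rule summable_on_comparison_test)
    fix x
    have "(cmod (c * F (x + k) + d * G (x + l)))\<^sup>2 \<le> (cmod (c * F (x + k)) + cmod (d * G (x + l)))\<^sup>2"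
      by (intro power_mono norm_triangle_ineq) auto
    also have "\<dots> \<le> 2 * (cmod (c * F (x + k)))\<^sup>2 + 2 * (cmod (d * G (x + l)))\<^sup>2"
      using sum_squares_bound[of "cmod (c * F (x + k))" "cmod (d * G (x + l))"]
      by (simp add: power2_sum)
    finally show "(cmod (c * F (x + k) + d * G (x + l)))\<^sup>2
        \<le> 2 * (cmod c)\<^sup>2 * (cmod (F (x + k)))\<^sup>2 + 2 * (cmod d)\<^sup>2 * (cmod (G (x + l)))\<^sup>2"
      by (simp add: norm_mult power_mult_distrib)
  qed auto
qed

lemma coin_entries:
  assumes "A = vector [vector [a, b], vector [- cnj b, cnj a]]"
  shows "A$1$1 = a" "A$1$2 = b" "A$2$1 = - cnj b" "(A :: complex^2^2)$2$2 = cnj a"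
  using assms by simp_all

lemma coin_unit:
  assumes "(cmod a)\<^sup>2 + (cmod b)\<^sup>2 = 1"
  shows "a * cnj a + b * cnj b = 1"
proof -
  have "a * cnj a + b * cnj b = complex_of_real ((cmod a)\<^sup>2 + (cmod b)\<^sup>2)"
    by (simp only: complex_norm_square of_real_add)
  thus ?thesis using assms by simp
qed

lemma walk_ell2:
  assumes "f \<in> ell2"
  shows "walk A f \<in> ell2"
  using ell2_lincomb[of "\<lambda>x. f x $ 1" "\<lambda>x. f x $ 2" "A$1$1" "-1" "A$1$2" 1]
    ell2_lincomb[of "\<lambda>x. f x $ 1" "\<lambda>x. f x $ 2" "A$2$1" "-1" "A$2$2" 1] assms
  by (simp add: ell2_iff walk_components)

lemma walk_unitary:
  assumes A: "A = vector [vector [a, b], vector [- cnj b, cnj a]]"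
    and unit: "(cmod a)\<^sup>2 + (cmod b)\<^sup>2 = 1"
  shows "bij_betw (walk A) ell2 ell2"
    and "\<And>f g. f \<in> ell2 \<Longrightarrow> g \<in> ell2 \<Longrightarrow> ell2_inner (walk A f) (walk A g) = ell2_inner f g"
proof -
  note [simp] = coin_entries[OF A]
  note u = coin_unit[OF unit]
  define V :: "state \<Rightarrow> state" where
    "V g = (\<lambda>x. vector [cnj a * g (x + 1) $ 1 + (- b) * g (x + 1) $ 2,
                        cnj b * g (x - 1) $ 1 + a * g (x - 1) $ 2])" for g
  have V1: "V g x $ 1 = cnj a * g (x + 1) $ 1 + (- b) * g (x + 1) $ 2"
    and V2: "V g x $ 2 = cnj b * g (x - 1) $ 1 + a * g (x - 1) $ 2" for g x
    by (simp_all add: V_def)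
  have VW: "V (walk A f) = f" for f
  proof (intro ext iffD2[OF vec_eq_iff] iffD2[OF forall_2] allI conjI)
    fix x
    have "V (walk A f) x $ 1 = (a * cnj a + b * cnj b) * f x $ 1"
      by (simp add: V1 walk_components algebra_simps)
    thus "V (walk A f) x $ 1 = f x $ 1" by (simp add: u)
    have "V (walk A f) x $ 2 = (a * cnj a + b * cnj b) * f x $ 2"
      by (simp add: V2 walk_components algebra_simps)
    thus "V (walk A f) x $ 2 = f x $ 2" by (simp add: u)
  qed
  have WV: "walk A (V g) = g" for g
  proof (intro ext iffD2[OF vec_eq_iff] iffD2[OF forall_2] allI conjI)
    fix x
    have "walk A (V g) x $ 1 = (a * cnj a + b * cnj b) * g x $ 1"
      by (simp add: V1 V2 walk_components algebra_simps)
    thus "walk A (V g) x $ 1 = g x $ 1" by (simp add: u)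
    have "walk A (V g) x $ 2 = (a * cnj a + b * cnj b) * g x $ 2"
      by (simp add: V1 V2 walk_components algebra_simps)
    thus "walk A (V g) x $ 2 = g x $ 2" by (simp add: u)
  qed
  have V_ell2: "V g \<in> ell2" if "g \<in> ell2" for g
    using ell2_lincomb[of "\<lambda>x. g x $ 1" "\<lambda>x. g x $ 2" "cnj a" 1 "- b" 1]
      ell2_lincomb[of "\<lambda>x. g x $ 1" "\<lambda>x. g x $ 2" "cnj b" "-1" "a" "-1"] that
    by (simp add: ell2_iff V1 V2)
  show "bij_betw (walk A) ell2 ell2"
    by (rule bij_betw_byWitness[of _ V]) (auto simp: VW WV walk_ell2 V_ell2)
  fix f g assume f: "f \<in> ell2" and g: "g \<in> ell2"
  define F where "F i x = cnj (f x $ i) * g x $ i" for i x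
  have F: "F i summable_on UNIV" for i
    using f g exhaust_2[of i] unfolding F_def by (auto simp: ell2_iff intro: ell2_mult_summable)
  have pt: "(\<Sum>i\<in>UNIV. cnj (walk A f x $ i) * walk A g x $ i) = F 1 (x + -1) + F 2 (x + 1)" for x
  proof -
    have "(\<Sum>i\<in>UNIV. cnj (walk A f x $ i) * walk A g x $ i)
        = (a * cnj a + b * cnj b) * (F 1 (x + -1) + F 2 (x + 1))"
      by (simp add: sum_2 walk_components F_def algebra_simps)
    thus ?thesis by (simp only: u mult_1)
  qed
  have "ell2_inner (walk A f) (walk A g) = (\<Sum>\<^sub>\<infinity>x. F 1 (x + -1) + F 2 (x + 1))"
    unfolding ell2_inner_def pt ..
  also have "\<dots> = (\<Sum>\<^sub>\<infinity>x. F 1 (x + -1)) + (\<Sum>\<^sub>\<infinity>x. F 2 (x + 1))"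
    by (rule infsum_add; subst shift_int_summable(1); rule F)
  also have "\<dots> = (\<Sum>\<^sub>\<infinity>x. F 1 x) + (\<Sum>\<^sub>\<infinity>x. F 2 x)"
    by (simp only: shift_int_summable(2))
  also have "\<dots> = (\<Sum>\<^sub>\<infinity>x. F 1 x + F 2 x)"
    by (rule infsum_add[symmetric]; rule F)
  also have "\<dots> = ell2_inner f g"
    by (simp add: ell2_inner_def F_def sum_2)
  finally show "ell2_inner (walk A f) (walk A g) = ell2_inner f g" .
qed

lemma trans_prob_has_sum:
  assumes A: "A = vector [vector [a, b], vector [- cnj b, cnj a]]"
    and unit: "(cmod a)\<^sup>2 + (cmod b)\<^sup>2 = 1" and \<phi>: "norm \<phi> = 1"
  shows "(trans_prob A \<phi> n has_sum 1) UNIV"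
proof -
  define f where "f = (\<lambda>n. (walk A ^^ n) (delta 0 \<phi>))"
  have mem: "f n \<in> ell2" for n
    by (induction n) (simp_all add: f_def delta_in_ell2 walk_ell2)
  have pt: "(\<Sum>i\<in>UNIV. cnj (h x $ i) * h x $ i) = complex_of_real ((norm (h x))\<^sup>2)"
    for h :: state and x
    by (simp add: norm_sq_2 sum_2 complex_norm_square mult.commute del: of_real_power)
  have "ell2_inner (delta 0 \<phi>) (delta 0 \<phi>)
      = (\<Sum>\<^sub>\<infinity>x\<in>{0 :: int}. complex_of_real ((norm (delta 0 \<phi> x))\<^sup>2))"
    unfolding ell2_inner_def pt by (rule infsum_cong_neutral) (auto simp: delta_def)
  also have "\<dots> = 1"
    using \<phi> by (simp add: delta_def)
  finally have d: "ell2_inner (delta 0 \<phi>) (delta 0 \<phi>) = 1" .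
  have "ell2_inner (f n) (f n) = 1"
  proof (induction n)
    case 0
    show ?case using d by (simp add: f_def)
  next
    case (Suc n)
    have "f (Suc n) = walk A (f n)" by (simp add: f_def)
    thus ?case using Suc walk_unitary(2)[OF A unit mem mem] by simp
  qed
  hence 1: "(\<Sum>\<^sub>\<infinity>x. complex_of_real ((norm (f n x))\<^sup>2)) = complex_of_real 1"
    unfolding ell2_inner_def pt by simp
  have "(\<lambda>x. (norm (f n x))\<^sup>2) summable_on UNIV"
    using mem[of n] by (simp add: ell2_def)
  hence s: "((\<lambda>x. (norm (f n x))\<^sup>2) has_sum (\<Sum>\<^sub>\<infinity>x. (norm (f n x))\<^sup>2)) UNIV"
    by (rule has_sum_infsum)
  have "(\<Sum>\<^sub>\<infinity>x. complex_of_real ((norm (f n x))\<^sup>2)) = complex_of_real (\<Sum>\<^sub>\<infinity>x. (norm (f n x))\<^sup>2)"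
    by (rule infsumI, rule has_sum_of_real, rule s)
  hence "(\<Sum>\<^sub>\<infinity>x. (norm (f n x))\<^sup>2) = 1"
    unfolding 1 of_real_eq_iff by simp
  hence "((\<lambda>x. (norm (f n x))\<^sup>2) has_sum 1) UNIV"
    using s by simp
  moreover have "trans_prob A \<phi> n = (\<lambda>x. (norm (f n x))\<^sup>2)"
    by (simp add: fun_eq_iff trans_prob_def f_def)
  ultimately show ?thesis by simp
qed

lemma emeasure_walk_measure:
  assumes "B \<in> sets borel"
  shows "emeasure (walk_measure A \<phi> n) B =
    (\<integral>\<^sup>+x. ennreal (trans_prob A \<phi> n x) * emeasure (return borel (real_of_int x / real n)) B
       \<partial>count_space UNIV)"
proof -
  have "emeasure (walk_measure A \<phi> n) B =
    (\<integral>\<^sup>+x. ennreal (trans_prob A \<phi> n x) * indicator ((\<lambda>x. real_of_int x / real n) -` B) x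
       \<partial>count_space UNIV)"
    using assms by (simp add: walk_measure_def emeasure_distr emeasure_density)
  also have "\<dots> = (\<integral>\<^sup>+x. ennreal (trans_prob A \<phi> n x) *
      emeasure (return borel (real_of_int x / real n)) B \<partial>count_space UNIV)"
    using assms by (intro nn_integral_cong) (simp add: indicator_def)
  finally show ?thesis .
qed

lemma real_distribution_walk_measure:
  assumes A: "A = vector [vector [a, b], vector [- cnj b, cnj a]]"
    and unit: "(cmod a)\<^sup>2 + (cmod b)\<^sup>2 = 1" and \<phi>: "norm \<phi> = 1"
  shows "real_distribution (walk_measure A \<phi> n)"
proof -
  note s = trans_prob_has_sum[OF A unit \<phi>, of n]
  have nonneg: "0 \<le> trans_prob A \<phi> n x" for x
    by (simp add: trans_prob_def)
  have "(\<lambda>x. norm (trans_prob A \<phi> n x)) summable_on UNIV"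
    using has_sum_imp_summable[OF s] nonneg by simp
  hence abs: "Infinite_Set_Sum.abs_summable_on (trans_prob A \<phi> n) UNIV"
    by (simp only: abs_summable_equivalent)
  have "(\<integral>\<^sup>+x. ennreal (trans_prob A \<phi> n x) \<partial>count_space UNIV)
      = ennreal (\<Sum>\<^sub>\<infinity>x. trans_prob A \<phi> n x)"
    using nn_integral_conv_infsetsum[OF abs nonneg] infsetsum_infsum[OF abs] by simp
  also have "(\<Sum>\<^sub>\<infinity>x. trans_prob A \<phi> n x) = 1"
    using s by (rule infsumI)
  finally have "prob_space (density (count_space UNIV) (\<lambda>x. ennreal (trans_prob A \<phi> n x)))"
    by (intro prob_spaceI) (simp add: emeasure_density)
  hence "prob_space (walk_measure A \<phi> n)"
    unfolding walk_measure_def by (rule prob_space.prob_space_distr) simp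
  thus ?thesis
    by (simp add: real_distribution_def real_distribution_axioms_def walk_measure_def)
qed

text \<open>In particular, passing to \<^typ>\<open>ennreal\<close> loses nothing in \<open>density lborel (limit_density a b \<phi>)\<close>.\<close>

lemma limit_density_nonneg:
  assumes unit: "(cmod a)\<^sup>2 + (cmod b)\<^sup>2 = 1" and a: "a \<noteq> 0" and \<phi>: "norm \<phi> = 1"
  shows "0 \<le> limit_density a b \<phi> y"
proof (cases "\<bar>y\<bar> < cmod a")
  case False
  thus ?thesis by (auto simp: limit_density_def indicator_def)
next
  case y: True
  define r s p q where "r = cmod a" and "s = cmod b" and "p = cmod (\<phi>$1)" and "q = cmod (\<phi>$2)"
  have r: "0 < r" and s: "0 \<le> s" and p: "0 \<le> p" and q: "0 \<le> q" and rs: "r\<^sup>2 + s\<^sup>2 = 1"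
    using a unit by (simp_all add: r_def s_def p_def q_def)
  have pq: "p\<^sup>2 + q\<^sup>2 = 1" using \<phi> norm_sq_2[of \<phi>] by (simp add: p_def q_def)
  define R where "R = Re (a * b * cnj (\<phi>$1) * \<phi>$2 + cnj a * cnj b * \<phi>$1 * cnj (\<phi>$2))"
  have "\<bar>R\<bar> \<le> cmod (a * b * cnj (\<phi>$1) * \<phi>$2 + cnj a * cnj b * \<phi>$1 * cnj (\<phi>$2))"
    unfolding R_def by (rule abs_Re_le_cmod)
  also have "\<dots> \<le> r * s * p * q + r * s * p * q"
    by (rule norm_triangle_le) (simp add: norm_mult r_def s_def p_def q_def)
  finally have R: "\<bar>R\<bar> \<le> 2 * (r * s * p * q)" by linarith
  have lam: "r * walk_lambda a b \<phi> = r * (p\<^sup>2 - q\<^sup>2) - R / r"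
    using r unfolding walk_lambda_def R_def[symmetric] r_def[symmetric] p_def[symmetric]
      q_def[symmetric] by (simp add: field_simps power2_eq_square)
  have "\<bar>R / r\<bar> \<le> s * (2 * p * q)"
    using R r by (simp add: abs_divide field_simps)
  hence "\<bar>r * walk_lambda a b \<phi>\<bar> \<le> r * \<bar>p\<^sup>2 - q\<^sup>2\<bar> + s * (2 * p * q)"
    unfolding lam using r abs_triangle_ineq4[of "r * (p\<^sup>2 - q\<^sup>2)" "R / r"]
    by (simp add: abs_mult)
  also have "\<dots> \<le> 1"
  proof (rule power2_le_imp_le)
    have "(r * \<bar>p\<^sup>2 - q\<^sup>2\<bar> + s * (2 * p * q))\<^sup>2 + (r * (2 * p * q) - s * \<bar>p\<^sup>2 - q\<^sup>2\<bar>)\<^sup>2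
        = (r\<^sup>2 + s\<^sup>2) * (\<bar>p\<^sup>2 - q\<^sup>2\<bar>\<^sup>2 + (2 * p * q)\<^sup>2)"
      by algebra
    also have "\<bar>p\<^sup>2 - q\<^sup>2\<bar>\<^sup>2 + (2 * p * q)\<^sup>2 = (p\<^sup>2 + q\<^sup>2)\<^sup>2"
      unfolding power2_abs by algebra
    finally have "(r * \<bar>p\<^sup>2 - q\<^sup>2\<bar> + s * (2 * p * q))\<^sup>2 + (r * (2 * p * q) - s * \<bar>p\<^sup>2 - q\<^sup>2\<bar>)\<^sup>2 = 1"
      by (simp add: rs pq)
    thus "(r * \<bar>p\<^sup>2 - q\<^sup>2\<bar> + s * (2 * p * q))\<^sup>2 \<le> 1\<^sup>2"
      using zero_le_power2[of "r * (2 * p * q) - s * \<bar>p\<^sup>2 - q\<^sup>2\<bar>"]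
      unfolding one_power2 by linarith
  qed simp
  finally have "\<bar>r * walk_lambda a b \<phi>\<bar> \<le> 1" .
  moreover have "\<bar>walk_lambda a b \<phi> * y\<bar> \<le> \<bar>r * walk_lambda a b \<phi>\<bar>"
    using y r by (simp add: abs_mult r_def mult.commute mult_right_mono)
  ultimately have "0 \<le> 1 + walk_lambda a b \<phi> * y" by linarith
  moreover have "y\<^sup>2 \<le> r\<^sup>2" using y r by (simp add: abs_le_square_iff[symmetric] r_def)
  hence "0 \<le> 1 - y\<^sup>2" using rs zero_le_power2[of s] by linarith
  ultimately show ?thesis using \<open>y\<^sup>2 \<le> r\<^sup>2\<close>
    unfolding limit_density_def r_def by (intro mult_nonneg_nonneg divide_nonneg_nonneg) auto
qed

end

theory Submission
  imports Defs
begin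

text \<open>
  The proof computes the limit of the characteristic functions (the Fourier method of Grimmett, Janson
  and Scudo). After the Fourier transform, one step of the walk is multiplication by a matrix
  \<open>U(k)\<close> in \<open>SU(2)\<close>. Write \<open>U = cos \<omega> + sin \<omega> \<cdot> N\<close> with \<open>N\<^sup>2 = -1\<close>; then
  \<open>U\<^sup>n = cos (n\<omega>) + sin (n\<omega>) \<cdot> N\<close>, and by Parseval the characteristic function of
  \<open>X\<^sub>n/n\<close> at \<open>t\<close> is the mean over \<open>k\<close> of \<open>\<langle>U(k)\<^sup>n \<phi>, U(k + t/n)\<^sup>n \<phi>\<rangle>\<close>.
  As \<open>n\<close> grows, \<open>N(k + t/n)\<close> tends to \<open>N(k)\<close> and the phase difference
  \<open>n\<omega>(k + t/n) - n\<omega>(k)\<close> to \<open>t \<omega>'(k)\<close>, so the integrand tends to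
  \<open>cos (t\<omega>') + sin (t\<omega>') \<langle>\<phi>, N\<phi>\<rangle>\<close>. The substitution \<open>y = \<omega>'(k)\<close>, under which
  \<open>|b| dy / ((1 - y\<^sup>2) \<surd>(|a|\<^sup>2 - y\<^sup>2)) = dk\<close>, turns the limit into the
  characteristic function of the stated density, and Levy's continuity theorem applies.
\<close>

section \<open>Parseval for finite trigonometric sums\<close>

lemma sum_shift_int_support:
  fixes f e :: "int \<Rightarrow> complex"
  assumes "\<And>x. int n < \<bar>x\<bar> \<Longrightarrow> f x = 0" and "\<bar>k\<bar> \<le> 1"
  shows "(\<Sum>x = - int (Suc n)..int (Suc n). f (x + k) * e x) = (\<Sum>x = - int n..int n. f x * e (x - k))"
proof -
  have "(\<Sum>x = - int n..int n. f x * e (x - k)) = (\<Sum>x = - int n - k..int n - k. f (x + k) * e x)"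
    by (rule sum.reindex_bij_witness[of _ "\<lambda>x. x + k" "\<lambda>x. x - k"]) auto
  \<comment> \<open>The displaced window lies in the larger one because
    \<open>\<bar>k\<bar> \<le> 1\<close>, and the added terms are outside the support of
    \<open>f\<close>.\<close>
  also have "\<dots> = (\<Sum>x = - int (Suc n)..int (Suc n). f (x + k) * e x)"
    using assms by (intro sum.mono_neutral_left) auto
  finally show ?thesis ..
qed

text \<open>Orthogonality of characters. The free start \<open>c\<close> allows a period from
  \<open>- (pi / 2)\<close>; the free offset \<open>\<theta>\<close> will be
  \<open>Arg a\<close>.\<close>

lemma has_integral_cis_int:
  fixes m :: int and \<theta> c :: real
  shows "((\<lambda>k. cis ((k - \<theta>) * of_int m)) has_integral (if m = 0 then 2 * pi else 0)) {c..c + 2 * pi}"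
proof (cases "m = 0")
  case True
  thus ?thesis using has_integral_const_real[of "1::complex" c "c + 2 * pi"]
    by (simp add: scaleR_conv_of_real)
next
  case False
  define F where "F k = cis ((k - \<theta>) * of_int m) / (\<i> * of_int m)" for k
  have d: "(F has_vector_derivative cis ((k - \<theta>) * of_int m)) (at k within T)" for k T
    unfolding F_def cis_conv_exp using False
    by (auto intro!: derivative_eq_intros has_vector_derivative_real_field simp: field_simps)
  have "F (c + 2 * pi) = cis ((c - \<theta>) * of_int m) * cis (2 * pi * of_int m) / (\<i> * of_int m)"
    unfolding F_def cis_mult by (simp add: algebra_simps)
  also have "cis (2 * pi * of_int m) = 1"
    by (rule cis_multiple_2pi) simp
  finally have "F (c + 2 * pi) - F c = 0" by (simp add: F_def)
  moreover have "((\<lambda>k. cis ((k - \<theta>) * of_int m)) has_integral (F (c + 2 * pi) - F c)) {c..c + 2 * pi}"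
    by (rule fundamental_theorem_of_calculus) (auto intro: d)
  ultimately show ?thesis using False by simp
qed

text \<open>Parseval with one factor translated: translation by \<open>\<eta>\<close> in momentum
  multiplies the coefficient at \<open>x\<close> by a phase, and \<open>\<theta>\<close> cancels
  against the conjugate.\<close>

lemma has_integral_fourier_pairing:
  fixes f :: "int \<Rightarrow> complex" and I :: "int set" and \<theta> \<eta> c :: real
  assumes I: "finite I"
  defines "F \<equiv> \<lambda>k. \<Sum>x\<in>I. f x * cis ((k - \<theta>) * of_int x)"
  shows "((\<lambda>k. cnj (F k) * F (k + \<eta>)) has_integral
           2 * pi * (\<Sum>x\<in>I. cnj (f x) * f x * cis (\<eta> * of_int x))) {c..c + 2 * pi}"
proof -
  define C where "C x y = cnj (f x) * f y * cis (\<eta> * of_int y)" for x y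
  have "cnj (F k) * F (k + \<eta>) = (\<Sum>x\<in>I. \<Sum>y\<in>I. C x y * cis ((k - \<theta>) * of_int (y - x)))" for k
  proof -
    have "cis ((k + \<eta> - \<theta>) * of_int y) * cis (- ((k - \<theta>) * of_int x))
        = cis (\<eta> * of_int y) * cis ((k - \<theta>) * of_int (y - x))" for x y
      by (simp add: cis_mult algebra_simps)
    thus ?thesis
      unfolding F_def cnj_sum sum_product C_def
      by (intro sum.cong refl) (simp add: cis_cnj mult_ac)
  qed
  moreover have "((\<lambda>k. \<Sum>x\<in>I. \<Sum>y\<in>I. C x y * cis ((k - \<theta>) * of_int (y - x))) has_integral
      (\<Sum>x\<in>I. \<Sum>y\<in>I. C x y * (if y - x = 0 then 2 * pi else 0))) {c..c + 2 * pi}"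
    by (intro has_integral_sum I has_integral_mult_right has_integral_cis_int)
  moreover have "(\<Sum>x\<in>I. \<Sum>y\<in>I. C x y * (if y - x = 0 then 2 * pi else 0)) = (\<Sum>x\<in>I. C x x * (2 * pi))"
  proof (intro sum.cong refl)
    fix x assume "x \<in> I"
    have "(\<Sum>y\<in>I. C x y * (if y - x = 0 then 2 * pi else 0)) = (\<Sum>y\<in>I. if y = x then C x x * (2 * pi) else 0)"
      by (intro sum.cong) auto
    thus "(\<Sum>y\<in>I. C x y * (if y - x = 0 then 2 * pi else 0)) = C x x * (2 * pi)"
      using I \<open>x \<in> I\<close> by simp
  qed
  ultimately show ?thesis by (simp add: C_def sum_distrib_left mult_ac)
qed

section \<open>Polynomial identities for the coin\<close>

text \<open>First row of \<open>U N = cos \<omega> N - sin \<omega>\<close>, applied to \<phi> and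
  cleared of the denominator \<open>q = sin \<omega>\<close>. Here \<open>c\<close>,
  \<open>d\<close> are the cosine and sine of \<open>k\<close>, \<open>R\<close>, \<open>T\<close>
  the moduli of \<open>a\<close>, \<open>b\<close>, and \<open>p1\<close>, \<open>p2\<close> the
  entries of \<phi>. With \<open>I\<close> and the conjugate \<open>B\<close> of \<beta> as
  independent variables, a polynomial identity remains.\<close>

lemma coin_square_row1: fixes R c d T B \<beta> q p1 p2 I :: complex
  assumes "I\<^sup>2 = - 1" "q\<^sup>2 = (R * d)\<^sup>2 + T\<^sup>2" "d\<^sup>2 + c\<^sup>2 = 1" "\<beta> * B = T\<^sup>2"
  shows "R * (c + I * d) * (I * R * d * p1 + \<beta> * (c - I * d) * p2)
    + \<beta> * (c - I * d) * (- B * (c + I * d) * p1 - I * R * d * p2)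
    = R * c * (I * R * d * p1 + \<beta> * (c - I * d) * p2) - q\<^sup>2 * p1"
  using assms by algebra
text \<open>Second row of the same matrix equation.\<close>

lemma coin_square_row2: fixes R c d T B \<beta> q p1 p2 I :: complex
  assumes "I\<^sup>2 = - 1" "q\<^sup>2 = (R * d)\<^sup>2 + T\<^sup>2" "d\<^sup>2 + c\<^sup>2 = 1" "\<beta> * B = T\<^sup>2"
  shows "- B * (c + I * d) * (I * R * d * p1 + \<beta> * (c - I * d) * p2)
    + R * (c - I * d) * (- B * (c + I * d) * p1 - I * R * d * p2)
    = R * c * (- B * (c + I * d) * p1 - I * R * d * p2) - q\<^sup>2 * p2"
  using assms by algebra
text \<open>Expresses that N(k) preserves the norm of \<phi>, with denominators cleared;
  \<open>f\<close>, \<open>g\<close> stand for the conjugates of \<open>p1\<close>,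
  \<open>p2\<close>.\<close>

lemma coin_norm_identity: fixes R c d T B \<beta> q p1 p2 f g I :: complex
  assumes "I\<^sup>2 = - 1" "q\<^sup>2 = (R * d)\<^sup>2 + T\<^sup>2" "d\<^sup>2 + c\<^sup>2 = 1" "\<beta> * B = T\<^sup>2"
   "f * p1 + g * p2 = 1"
  shows "(- I * R * d * f + B * (c + I * d) * g) * (I * R * d * p1 + \<beta> * (c - I * d) * p2)
    + (- \<beta> * (c - I * d) * f + I * R * d * g) * (- B * (c + I * d) * p1 - I * R * d * p2) = q\<^sup>2"
  using assms by algebra

text \<open>Here (u, v) is \<phi>, (x, y) and (x', y') are \<open>N\<close> at \<open>k\<close> and
  \<open>k + \<eta>\<close>, and \<open>f\<close>, \<open>h\<close>, \<open>n\<close>,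
  \<open>m\<close> are the conjugates of \<open>u\<close>, \<open>v\<close>, \<open>x\<close>,
  \<open>y\<close>. Comparing x' with x separates a part that sees only the phase difference from an
  error that vanishes with \<eta>.\<close>

lemma pairing_expand:
  fixes c c' d d' f h n m G u v x y x' y' :: complex
  assumes "f * u + h * v = 1" "n * x + m * y = 1" "n * u + m * v = - G" "f * x + h * y = G"
  shows "(c * f + d * n) * (c' * u + d' * x') + (c * h + d * m) * (c' * v + d' * y')
    = (c' * c + d' * d) + G * (d' * c - c' * d)
      + c * d' * (f * (x' - x) + h * (y' - y)) + d * d' * (n * (x' - x) + m * (y' - y))"
proof -
  have "(c * f + d * n) * (c' * u + d' * x') + (c * h + d * m) * (c' * v + d' * y')
    = c * c' * (f * u + h * v) + d * c' * (n * u + m * v) + c * d' * (f * x' + h * y') + d * d' * (n * x' + m * y')"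
    by (simp add: algebra_simps)
  moreover have "f * (x' - x) + h * (y' - y) = (f * x' + h * y') - (f * x + h * y)"
    "n * (x' - x) + m * (y' - y) = (n * x' + m * y') - (n * x + m * y)"
    by (simp_all add: algebra_simps)
  ultimately show ?thesis unfolding assms by (simp add: algebra_simps)
qed

locale coined_walk =
  fixes a b :: complex and A :: "complex^2^2" and \<phi> :: "complex^2"
  assumes unit: "(cmod a)\<^sup>2 + (cmod b)\<^sup>2 = 1"
    and A: "A = vector [vector [a, b], vector [- cnj b, cnj a]]"
    and a: "a \<noteq> 0" and b: "b \<noteq> 0"
    and \<phi>: "norm \<phi> = 1"
begin

text \<open>
  Momentum is shifted by the argument of \<open>a\<close>, which replaces \<open>a\<close> by \<open>r\<close> and \<open>b\<close> by \<open>\<beta>\<close> in the coin.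
  Here \<open>S = sin \<omega>\<close>, \<open>vel = \<omega>'\<close>, and \<open>N k\<close> stands for the vector \<open>N(k) \<phi>\<close>.
\<close>

definition r where "r = cmod a"
definition s where "s = cmod b"
definition \<beta> where "\<beta> = b * cis (Arg a)"
definition S where "S k = sqrt (1 - (r * cos k)\<^sup>2)"
definition \<omega> where "\<omega> k = arccos (r * cos k)"
definition vel where "vel k = r * sin k / S k"
definition N :: "real \<Rightarrow> complex^2" where
  "N k = vector [(\<i> * r * of_real (sin k) * \<phi>$1 + \<beta> * cis (- k) * \<phi>$2) / S k,
                 (- cnj \<beta> * cis k * \<phi>$1 - \<i> * r * of_real (sin k) * \<phi>$2) / S k]"
definition \<psi> where "\<psi> n = (walk A ^^ n) (delta 0 \<phi>)"
definition \<Psi> :: "nat \<Rightarrow> real \<Rightarrow> 2 \<Rightarrow> complex" where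
  "\<Psi> n k i = (\<Sum>x = - int n..int n. \<psi> n x $ i * cis ((k - Arg a) * x))"

section \<open>Dispersion relation and group velocity\<close>

lemma r_pos: "0 < r" and s_pos: "0 < s" and rs: "r\<^sup>2 + s\<^sup>2 = 1"
  using a b unit by (auto simp: r_def s_def)

lemma a_eq: "a = r * cis (Arg a)"
  using a by (simp add: r_def rcis_cmod_Arg[unfolded rcis_def])

lemma \<beta>_cnj: "\<beta> * cnj \<beta> = of_real (s\<^sup>2)"
proof -
  have "cmod \<beta> = s" by (simp add: \<beta>_def s_def norm_mult)
  thus ?thesis by (metis complex_norm_square)
qed

text \<open>Since \<open>b \<noteq> 0\<close> gives \<open>s > 0\<close>, the bound
  \<open>s \<le> S k\<close> keeps \<open>sin \<omega>\<close> away from 0, so that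
  \<open>vel\<close> and \<open>N\<close> have no singularities.\<close>

lemma S_sq: "(S k)\<^sup>2 = (r * sin k)\<^sup>2 + s\<^sup>2" and S_sq': "(S k)\<^sup>2 = 1 - (r * cos k)\<^sup>2"
  and S_ge: "s \<le> S k"
proof -
  have eq: "1 - (r * cos k)\<^sup>2 = (r * sin k)\<^sup>2 + s\<^sup>2"
    using rs sin_cos_squared_add[of k] by algebra
  moreover have "0 \<le> (r * sin k)\<^sup>2 + s\<^sup>2" by simp
  ultimately show "(S k)\<^sup>2 = (r * sin k)\<^sup>2 + s\<^sup>2" "(S k)\<^sup>2 = 1 - (r * cos k)\<^sup>2"
    unfolding S_def by simp_all
  show "s \<le> S k" unfolding S_def eq using s_pos by (intro real_le_rsqrt) simp
qed

lemma S_pos: "0 < S k" using S_ge[of k] s_pos by linarith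

lemma r_cos_bounds: "- 1 < r * cos k" "r * cos k < 1"
proof -
  have "0 < (S k)\<^sup>2" using S_pos[of k] by simp
  hence "(r * cos k)\<^sup>2 < 1\<^sup>2" unfolding S_sq' by simp
  hence "\<bar>r * cos k\<bar> < 1" by (simp add: abs_square_less_1)
  thus "- 1 < r * cos k" "r * cos k < 1" by linarith+
qed

lemma cos_\<omega>: "cos (\<omega> k) = r * cos k" and sin_\<omega>: "sin (\<omega> k) = S k"
  unfolding \<omega>_def S_def using r_cos_bounds[of k] by (auto simp: sin_arccos)

lemma \<omega>_deriv: "(\<omega> has_real_derivative vel k) (at k)"
  unfolding \<omega>_def vel_def S_def using r_cos_bounds[of k] S_pos[of k, unfolded S_def]
  by (auto intro!: derivative_eq_intros simp: field_simps)

text \<open>After the quotient rule, \<open>S_sq\<close> reduces the numerator to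
  \<open>r * s\<^sup>2 * cos k\<close>, whose sign makes \<open>vel\<close> increasing on
  \<open>[-pi/2, pi/2]\<close>.\<close>

lemma vel_deriv: "(vel has_real_derivative r * s\<^sup>2 * cos k / (S k) ^ 3) (at k)"
proof -
  have "1 - (r * cos k)\<^sup>2 > 0" using S_pos[of k] by (simp add: S_def)
  hence "(S has_real_derivative r\<^sup>2 * cos k * sin k / S k) (at k)"
    unfolding S_def by (auto intro!: derivative_eq_intros simp: field_simps power2_eq_square)
  hence "(vel has_real_derivative (r * cos k * S k - r * sin k * (r\<^sup>2 * cos k * sin k / S k)) / (S k)\<^sup>2) (at k)"
    unfolding vel_def using S_pos[of k]
    by (auto intro!: derivative_eq_intros simp: power2_eq_square)
  moreover have "(r * cos k * S k - r * sin k * (r\<^sup>2 * cos k * sin k / S k)) / (S k)\<^sup>2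
    = r * cos k * ((S k)\<^sup>2 - (r * sin k)\<^sup>2) / (S k) ^ 3"
    using S_pos[of k] by (simp add: field_simps power2_eq_square power3_eq_cube)
  ultimately show ?thesis by (simp add: S_sq mult_ac)
qed

text \<open>These are the factors in the denominator of the limit density at
  \<open>y = vel k\<close>, the second one under the square root.\<close>

lemma vel_sq: "1 - (vel k)\<^sup>2 = s\<^sup>2 / (S k)\<^sup>2" "r\<^sup>2 - (vel k)\<^sup>2 = (r * s * cos k / S k)\<^sup>2"
proof -
  have "(vel k)\<^sup>2 = (r * sin k)\<^sup>2 / (S k)\<^sup>2" by (simp add: vel_def power_divide)
  hence 1: "(S k)\<^sup>2 * (vel k)\<^sup>2 = (r * sin k)\<^sup>2" using S_pos[of k] by simp
  show "1 - (vel k)\<^sup>2 = s\<^sup>2 / (S k)\<^sup>2"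
    using 1 S_pos[of k] by (simp add: field_simps) (simp add: S_sq field_simps)
  have "(S k)\<^sup>2 * (r\<^sup>2 - (vel k)\<^sup>2) = (r * s * cos k)\<^sup>2"
    using 1 S_sq[of k] S_sq'[of k] rs sin_cos_squared_add[of k] by algebra
  thus "r\<^sup>2 - (vel k)\<^sup>2 = (r * s * cos k / S k)\<^sup>2"
    using S_pos[of k] by (simp add: power_divide nonzero_eq_divide_eq mult.commute)
qed

section \<open>The coin as a rotation\<close>

lemma \<phi>_unit: "cnj (\<phi>$1) * \<phi>$1 + cnj (\<phi>$2) * \<phi>$2 = 1"
  using \<phi> norm_sq_2[of \<phi>]
  by (metis (no_types, lifting) complex_norm_square mult.commute of_real_1 of_real_add one_power2)

lemma complex_trig_eqs:
  "\<i>\<^sup>2 = - 1"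
  "(of_real (S k))\<^sup>2 = (of_real r * of_real (sin k))\<^sup>2 + (of_real s :: complex)\<^sup>2"
  "(of_real (sin k))\<^sup>2 + (of_real (cos k))\<^sup>2 = (1 :: complex)"
  "\<beta> * cnj \<beta> = (of_real s)\<^sup>2"
  using arg_cong[OF S_sq[of k], of "of_real :: real \<Rightarrow> complex"] \<beta>_cnj
  by (simp_all flip: of_real_power of_real_add of_real_mult)

lemma cis_cartesian:
  "cis k = of_real (cos k) + \<i> * of_real (sin k)" "cis (- k) = of_real (cos k) - \<i> * of_real (sin k)"
  by (simp_all add: complex_eq_iff)

lemma N_1: "S k * N k $ 1
    = \<i> * r * of_real (sin k) * \<phi>$1 + \<beta> * (of_real (cos k) - \<i> * of_real (sin k)) * \<phi>$2"
  and N_2: "S k * N k $ 2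
    = - cnj \<beta> * (of_real (cos k) + \<i> * of_real (sin k)) * \<phi>$1 - \<i> * r * of_real (sin k) * \<phi>$2"
  using S_pos[of k] unfolding N_def cis_cartesian by simp_all

text \<open>Together with \<open>coin_N\<close>: the coin acts on the pair \<phi>,
  \<open>N k\<close> as a rotation by \<open>\<omega> k\<close>, so its powers need no
  diagonalisation.\<close>

lemma coin_\<phi>:
  "r * cis k * \<phi>$1 + \<beta> * cis (- k) * \<phi>$2 = r * of_real (cos k) * \<phi>$1 + S k * N k $ 1"
  "- cnj \<beta> * cis k * \<phi>$1 + r * cis (- k) * \<phi>$2 = r * of_real (cos k) * \<phi>$2 + S k * N k $ 2"
  unfolding N_1 N_2 cis_cartesian by (simp_all add: algebra_simps)

lemma coin_N:
  "r * cis k * N k $ 1 + \<beta> * cis (- k) * N k $ 2 = r * of_real (cos k) * N k $ 1 - S k * \<phi>$1"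
  "- cnj \<beta> * cis k * N k $ 1 + r * cis (- k) * N k $ 2 = r * of_real (cos k) * N k $ 2 - S k * \<phi>$2"
proof -
  have nz: "complex_of_real (S k) \<noteq> 0" using S_pos[of k] by simp
  have "S k * (r * cis k * N k $ 1 + \<beta> * cis (- k) * N k $ 2)
      = S k * (r * of_real (cos k) * N k $ 1 - S k * \<phi>$1)"
    using coin_square_row1[OF complex_trig_eqs(1) complex_trig_eqs(2)[of k] complex_trig_eqs(3)[of k] complex_trig_eqs(4), of "\<phi>$1" "\<phi>$2", folded N_1 N_2]
    by (simp add: cis_cartesian algebra_simps power2_eq_square)
  thus "r * cis k * N k $ 1 + \<beta> * cis (- k) * N k $ 2 = r * of_real (cos k) * N k $ 1 - S k * \<phi>$1"
    using nz by (simp only: mult_left_cancel simp_thms)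
  have "S k * (- cnj \<beta> * cis k * N k $ 1 + r * cis (- k) * N k $ 2)
      = S k * (r * of_real (cos k) * N k $ 2 - S k * \<phi>$2)"
    using coin_square_row2[OF complex_trig_eqs(1) complex_trig_eqs(2)[of k] complex_trig_eqs(3)[of k] complex_trig_eqs(4), of "\<phi>$1" "\<phi>$2", folded N_1 N_2]
    by (simp add: cis_cartesian algebra_simps power2_eq_square)
  thus "- cnj \<beta> * cis k * N k $ 1 + r * cis (- k) * N k $ 2 = r * of_real (cos k) * N k $ 2 - S k * \<phi>$2"
    using nz by (simp only: mult_left_cancel simp_thms)
qed

lemma N_unit: "cnj (N k $ 1) * N k $ 1 + cnj (N k $ 2) * N k $ 2 = 1"
proof -
  have nz: "complex_of_real (S k) \<noteq> 0" using S_pos[of k] by simp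
  have c: "- \<i> * r * of_real (sin k) * cnj (\<phi>$1) + cnj \<beta> * (of_real (cos k) + \<i> * of_real (sin k)) * cnj (\<phi>$2)
      = S k * cnj (N k $ 1)"
    "- \<beta> * (of_real (cos k) - \<i> * of_real (sin k)) * cnj (\<phi>$1) + \<i> * r * of_real (sin k) * cnj (\<phi>$2)
      = S k * cnj (N k $ 2)"
    using arg_cong[OF N_1[of k], of cnj] arg_cong[OF N_2[of k], of cnj] by simp_all
  have "(S k * S k) * (cnj (N k $ 1) * N k $ 1 + cnj (N k $ 2) * N k $ 2) = of_real (S k * S k) * 1"
    using coin_norm_identity[OF complex_trig_eqs(1) complex_trig_eqs(2)[of k] complex_trig_eqs(3)[of k] complex_trig_eqs(4) \<phi>_unit, folded N_1 N_2, unfolded c]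
    by (simp add: algebra_simps power2_eq_square)
  thus ?thesis using nz by (simp only: mult_left_cancel of_real_mult mult_eq_0_iff simp_thms)
qed

section \<open>Fourier transform of the walk\<close>

text \<open>One step reaches only neighbouring sites; hence the finite sum in \<open>\<Psi>\<close>
  is the full Fourier transform.\<close>

lemma \<psi>_support: "int n < \<bar>x\<bar> \<Longrightarrow> \<psi> n x = 0"
proof (induction n arbitrary: x)
  case 0
  thus ?case by (auto simp: \<psi>_def delta_def)
next
  case (Suc n)
  have "\<psi> n (x - 1) = 0" "\<psi> n (x + 1) = 0"
    using Suc.prems by (auto intro!: Suc.IH)
  moreover have "\<psi> (Suc n) x = walk A (\<psi> n) x" by (simp add: \<psi>_def)
  ultimately show ?case by (simp add: vec_eq_iff forall_2 walk_components)
qed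

text \<open>Translation of sites becomes a phase. The offset \<open>Arg a\<close> in
  \<open>\<Psi>\<close> cancels the argument of \<open>a\<close> on the diagonal and moves it into
  \<beta>.\<close>

lemma \<Psi>_Suc:
  "\<Psi> (Suc n) k 1 = r * cis k * \<Psi> n k 1 + \<beta> * cis (- k) * \<Psi> n k 2"
  "\<Psi> (Suc n) k 2 = - cnj \<beta> * cis k * \<Psi> n k 1 + r * cis (- k) * \<Psi> n k 2"
proof -
  note [simp] = coin_entries[OF A]
  have S: "\<psi> (Suc n) = walk A (\<psi> n)" by (simp add: \<psi>_def)
  define e where "e x = cis ((k - Arg a) * of_int x)" for x :: int
  have e_shift: "e (x + 1) = cis (k - Arg a) * e x" "e (x - 1) = cis (Arg a - k) * e x" for x
    by (simp_all add: e_def cis_mult algebra_simps)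
  have sh: "(\<Sum>x = - int (Suc n)..int (Suc n). \<psi> n (x - 1) $ i * e x) = cis (k - Arg a) * \<Psi> n k i"
    "(\<Sum>x = - int (Suc n)..int (Suc n). \<psi> n (x + 1) $ i * e x) = cis (Arg a - k) * \<Psi> n k i" for i
    unfolding \<Psi>_def e_def[symmetric]
    using sum_shift_int_support[of n "\<lambda>x. \<psi> n x $ i" "-1" e] sum_shift_int_support[of n "\<lambda>x. \<psi> n x $ i" 1 e]
    by (simp_all add: \<psi>_support sum_distrib_left e_shift mult_ac)
  have comb: "(\<Sum>x = - int (Suc n)..int (Suc n). (c * \<psi> n (x - 1) $ 1 + d * \<psi> n (x + 1) $ 2) * e x)
      = c * (cis (k - Arg a) * \<Psi> n k 1) + d * (cis (Arg a - k) * \<Psi> n k 2)" for c d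
    unfolding sh[symmetric] by (simp add: sum.distrib sum_distrib_left algebra_simps)
  have "\<Psi> (Suc n) k 1 = a * (cis (k - Arg a) * \<Psi> n k 1) + b * (cis (Arg a - k) * \<Psi> n k 2)"
    unfolding comb[symmetric] by (simp add: \<Psi>_def S walk_components e_def)
  moreover have "a * cis (k - Arg a) = r * cis k" "cnj a * cis (Arg a - k) = r * cis (- k)"
    by (subst a_eq; simp add: cis_cnj mult.assoc cis_mult)+
  moreover have "b * cis (Arg a - k) = \<beta> * cis (- k)" "cnj b * cis (k - Arg a) = cnj \<beta> * cis k"
    by (simp_all add: \<beta>_def cis_cnj mult.assoc cis_mult)
  moreover have "\<Psi> (Suc n) k 2 = - cnj b * (cis (k - Arg a) * \<Psi> n k 1) + cnj a * (cis (Arg a - k) * \<Psi> n k 2)"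
    unfolding comb[symmetric] by (simp add: \<Psi>_def S walk_components e_def)
  ultimately show "\<Psi> (Suc n) k 1 = r * cis k * \<Psi> n k 1 + \<beta> * cis (- k) * \<Psi> n k 2"
    "\<Psi> (Suc n) k 2 = - cnj \<beta> * cis k * \<Psi> n k 1 + r * cis (- k) * \<Psi> n k 2"
    by (simp_all flip: mult.assoc)
qed

lemma \<Psi>_eq:
  "\<Psi> n k i = of_real (cos (n * \<omega> k)) * \<phi> $ i + of_real (sin (n * \<omega> k)) * N k $ i"
proof -
  have "\<Psi> n k 1 = of_real (cos (n * \<omega> k)) * \<phi> $ 1 + of_real (sin (n * \<omega> k)) * N k $ 1 \<and>
        \<Psi> n k 2 = of_real (cos (n * \<omega> k)) * \<phi> $ 2 + of_real (sin (n * \<omega> k)) * N k $ 2"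
  proof (induction n)
    case 0
    show ?case by (simp add: \<Psi>_def \<psi>_def delta_def)
  next
    case (Suc n)
    define c d where "c = complex_of_real (cos (n * \<omega> k))" and "d = complex_of_real (sin (n * \<omega> k))"
    have cd: "complex_of_real (cos (Suc n * \<omega> k)) = c * (r * of_real (cos k)) - d * S k"
      "complex_of_real (sin (Suc n * \<omega> k)) = d * (r * of_real (cos k)) + c * S k"
      by (simp_all add: c_def d_def ring_distribs cos_add sin_add cos_\<omega> sin_\<omega> add.commute[of "\<omega> k"])
    have "\<Psi> (Suc n) k 1 = c * (r * cis k * \<phi>$1 + \<beta> * cis (- k) * \<phi>$2)
        + d * (r * cis k * N k $ 1 + \<beta> * cis (- k) * N k $ 2)"
      unfolding \<Psi>_Suc c_def d_def by (simp add: Suc algebra_simps)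
    moreover have "\<Psi> (Suc n) k 2 = c * (- cnj \<beta> * cis k * \<phi>$1 + r * cis (- k) * \<phi>$2)
        + d * (- cnj \<beta> * cis k * N k $ 1 + r * cis (- k) * N k $ 2)"
      unfolding \<Psi>_Suc c_def d_def by (simp add: Suc algebra_simps)
    ultimately show ?case unfolding coin_\<phi> coin_N cd by (simp add: algebra_simps)
  qed
  thus ?thesis using exhaust_2[of i] by metis
qed

section \<open>Characteristic functions as momentum averages\<close>

definition lam where "lam = walk_lambda a b \<phi>"
definition \<mu> where "\<mu> = 2 * Im (\<beta> * cnj (\<phi>$1) * \<phi>$2)"
text \<open>\<open>\<i> * g k\<close> is the expectation of the skew-Hermitian matrix N(k) in the
  state \<phi>; see \<open>\<phi>_N\<close>.\<close>

definition g where "g k = lam * vel k + \<mu> * cos k / S k"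
definition J where "J n k \<eta> = cnj (\<Psi> n k 1) * \<Psi> n (k + \<eta>) 1 + cnj (\<Psi> n k 2) * \<Psi> n (k + \<eta>) 2"

text \<open>Parseval in each component with \<open>\<eta> = t / n\<close>: the phases are those of
  the characteristic function at \<open>t\<close>, and the squared moduli of the two entries add up
  to the transition probability.\<close>

lemma char_walk_measure:
  "((\<lambda>k. J n k (t / n)) has_integral 2 * pi * char (walk_measure A \<phi> n) t) {c..c + 2 * pi}"
proof -
  define p where "p x = cnj (\<psi> n x $ 1) * \<psi> n x $ 1 + cnj (\<psi> n x $ 2) * \<psi> n x $ 2" for x
  have p: "complex_of_real (trans_prob A \<phi> n x) = p x" for x
    by (simp add: trans_prob_def \<psi>_def p_def norm_sq_2 complex_norm_square mult.commute del: of_real_power)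
  have nonneg: "0 \<le> trans_prob A \<phi> n x" for x by (simp add: trans_prob_def)
  have supp: "p x = 0" if "x \<notin> {- int n..int n}" for x
    using that \<psi>_support[of n x] by (auto simp: p_def)
  have "char (walk_measure A \<phi> n) t
      = (\<integral>x. trans_prob A \<phi> n x *\<^sub>R iexp (t * (of_int x / n)) \<partial>count_space UNIV)"
    unfolding char_def walk_measure_def
    by (subst integral_distr; (subst integral_density)?) (auto simp: nonneg)
  also have "\<dots> = (\<integral>x. p x * cis (t / n * of_int x) \<partial>count_space UNIV)"
    by (simp add: scaleR_conv_of_real p cis_conv_exp)
  also have "\<dots> = (\<Sum>x = - int n..int n. p x * cis (t / n * of_int x))"
  proof (subst lebesgue_integral_count_space_finite_support)
    have sub: "{x \<in> UNIV. p x * cis (t / n * of_int x) \<noteq> 0} \<subseteq> {- int n..int n}"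
      by (intro subsetI, rule ccontr) (use supp in auto)
    show "finite {x \<in> UNIV. p x * cis (t / n * of_int x) \<noteq> 0}"
      by (rule finite_subset[OF sub]) simp
    show "(\<Sum>x | x \<in> UNIV \<and> p x * cis (t / n * of_int x) \<noteq> 0. p x * cis (t / n * of_int x))
        = (\<Sum>x = - int n..int n. p x * cis (t / n * of_int x))"
      using sub by (intro sum.mono_neutral_left) auto
  qed
  finally have ch: "char (walk_measure A \<phi> n) t = (\<Sum>x = - int n..int n. p x * cis (t / n * of_int x))" .
  have "((\<lambda>k. J n k (t / n)) has_integral
      2 * pi * (\<Sum>x = - int n..int n. cnj (\<psi> n x $ 1) * \<psi> n x $ 1 * cis (t / n * of_int x)) +
      2 * pi * (\<Sum>x = - int n..int n. cnj (\<psi> n x $ 2) * \<psi> n x $ 2 * cis (t / n * of_int x))) {c..c + 2 * pi}"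
    unfolding J_def \<Psi>_def
    by (intro has_integral_add has_integral_fourier_pairing) auto
  thus ?thesis by (simp add: ch p_def sum.distrib ring_distribs)
qed

text \<open>The two summands of the cross term are conjugate to each other, and
  \<open>a * b = r * \<beta>\<close> cancels one factor of the denominator.\<close>

lemma walk_lambda_eq: "lam = (cmod (\<phi>$1))\<^sup>2 - (cmod (\<phi>$2))\<^sup>2 - 2 * Re (\<beta> * cnj (\<phi>$1) * \<phi>$2) / r"
proof -
  define W where "W = \<beta> * cnj (\<phi>$1) * \<phi>$2"
  have W: "a * b * cnj (\<phi>$1) * \<phi>$2 = r * W"
    using arg_cong[OF a_eq, of "\<lambda>z. z * b * cnj (\<phi>$1) * \<phi>$2"] by (simp only: \<beta>_def W_def mult_ac)
  have "cnj a * cnj b * \<phi>$1 * cnj (\<phi>$2) = cnj (a * b * cnj (\<phi>$1) * \<phi>$2)" by simp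
  hence "Re (a * b * cnj (\<phi>$1) * \<phi>$2 + cnj a * cnj b * \<phi>$1 * cnj (\<phi>$2)) = 2 * r * Re W"
    unfolding W by simp
  thus ?thesis using r_pos
    unfolding lam_def walk_lambda_def r_def[symmetric] W_def[symmetric]
    by (simp add: field_simps power2_eq_square)
qed

lemma \<phi>_N: "cnj (\<phi>$1) * N k $ 1 + cnj (\<phi>$2) * N k $ 2 = \<i> * g k"
proof -
  define W where "W = \<beta> * cnj (\<phi>$1) * \<phi>$2"
  have "S k * (cnj (\<phi>$1) * N k $ 1 + cnj (\<phi>$2) * N k $ 2)
      = cnj (\<phi>$1) * (S k * N k $ 1) + cnj (\<phi>$2) * (S k * N k $ 2)"
    by (simp add: algebra_simps)
  also have "\<dots> = \<i> * of_real (r * sin k) * (\<phi>$1 * cnj (\<phi>$1) - \<phi>$2 * cnj (\<phi>$2))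
      + (W * (of_real (cos k) - \<i> * of_real (sin k)) - cnj W * (of_real (cos k) + \<i> * of_real (sin k)))"
    unfolding N_1 N_2 by (simp add: W_def algebra_simps)
  \<comment> \<open>The last bracket is \<open>2 * \<i>\<close> times the imaginary part of
    \<open>W * cis (- k)\<close>. Its sine part joins the difference of squares to form
    \<open>lam\<close>; its cosine part is the \<mu> term.\<close>
  also have "\<dots> = \<i> * of_real (r * sin k * ((cmod (\<phi>$1))\<^sup>2 - (cmod (\<phi>$2))\<^sup>2)
      + 2 * Im W * cos k - 2 * Re W * sin k)"
    unfolding complex_norm_square[symmetric] by (simp add: complex_eq_iff)
  also have "r * sin k * ((cmod (\<phi>$1))\<^sup>2 - (cmod (\<phi>$2))\<^sup>2) + 2 * Im W * cos k - 2 * Re W * sin k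
      = S k * g k"
  proof -
    have "S k * vel k = r * sin k" "S k * (\<mu> * cos k / S k) = \<mu> * cos k"
      using S_pos[of k] by (simp_all add: vel_def)
    hence "S k * g k = (lam * r) * sin k + \<mu> * cos k"
      unfolding g_def ring_distribs by (simp add: mult.left_commute)
    also have "lam * r = r * ((cmod (\<phi>$1))\<^sup>2 - (cmod (\<phi>$2))\<^sup>2) - 2 * Re W"
      using r_pos unfolding walk_lambda_eq W_def[symmetric] by (simp add: field_simps)
    finally show ?thesis by (simp only: \<mu>_def W_def[symmetric]) (simp add: algebra_simps)
  qed
  finally have "S k * (cnj (\<phi>$1) * N k $ 1 + cnj (\<phi>$2) * N k $ 2) = S k * (\<i> * g k)"
    by (simp add: mult_ac)
  thus ?thesis by (rule mult_left_cancel[THEN iffD1, rotated]) (use S_pos[of k] in simp)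
qed

text \<open>The leading terms see the two phases only through \<open>D\<close>, which converges when
  \<open>\<eta> = t / n\<close>; the remaining ones carry increments of \<open>N\<close> with
  bounded factors.\<close>

lemma J_eq:
  fixes k \<eta> and n :: nat
  defines "c \<equiv> cos (n * \<omega> k)" and "c' \<equiv> cos (n * \<omega> (k + \<eta>))"
    and "d \<equiv> sin (n * \<omega> k)" and "d' \<equiv> sin (n * \<omega> (k + \<eta>))"
    and "D \<equiv> n * \<omega> (k + \<eta>) - n * \<omega> k"
  shows "J n k \<eta> = of_real (cos D) + \<i> * g k * of_real (sin D)
    + of_real (c * d') * (cnj (\<phi>$1) * (N (k + \<eta>) $ 1 - N k $ 1) + cnj (\<phi>$2) * (N (k + \<eta>) $ 2 - N k $ 2))
    + of_real (d * d') * (cnj (N k $ 1) * (N (k + \<eta>) $ 1 - N k $ 1) + cnj (N k $ 2) * (N (k + \<eta>) $ 2 - N k $ 2))"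
proof -
  have cD: "complex_of_real (cos D) = of_real c' * of_real c + of_real d' * of_real d"
    and sD: "complex_of_real (sin D) = of_real d' * of_real c - of_real c' * of_real d"
    by (simp_all add: D_def c_def c'_def d_def d'_def cos_diff sin_diff)
  have N\<phi>: "cnj (N k $ 1) * \<phi>$1 + cnj (N k $ 2) * \<phi>$2 = - (\<i> * g k)"
    using arg_cong[OF \<phi>_N[of k], of cnj] by (simp add: mult.commute)
  note eqs = \<phi>_unit N_unit[of k] N\<phi> \<phi>_N[of k]
  show ?thesis unfolding J_def \<Psi>_eq cD sD c_def[symmetric] c'_def[symmetric] d_def[symmetric] d'_def[symmetric]
      complex_cnj_add complex_cnj_mult complex_cnj_complex_of_real of_real_mult
    by (rule pairing_expand[OF eqs])
qed

section \<open>Pointwise limit of the integrand\<close>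

lemma norm_N_le: "cmod (N k $ 1) \<le> 1" "cmod (N k $ 2) \<le> 1"
  and norm_\<phi>_le: "cmod (\<phi>$1) \<le> 1" "cmod (\<phi>$2) \<le> 1"
proof -
  have *: "cmod x \<le> 1 \<and> cmod y \<le> 1" if "cnj x * x + cnj y * y = 1" for x y
  proof -
    have "complex_of_real ((cmod x)\<^sup>2 + (cmod y)\<^sup>2) = cnj x * x + cnj y * y"
      by (simp add: complex_norm_square mult.commute del: of_real_power)
    hence "(cmod x)\<^sup>2 + (cmod y)\<^sup>2 = 1\<^sup>2" unfolding that of_real_eq_1_iff by simp
    hence "(cmod x)\<^sup>2 \<le> 1\<^sup>2" "(cmod y)\<^sup>2 \<le> 1\<^sup>2"
      using zero_le_power2[of "cmod x"] zero_le_power2[of "cmod y"] by linarith+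
    thus ?thesis by (intro conjI; elim power2_le_imp_le) simp_all
  qed
  show "cmod (N k $ 1) \<le> 1" "cmod (N k $ 2) \<le> 1" "cmod (\<phi>$1) \<le> 1" "cmod (\<phi>$2) \<le> 1"
    using *[OF N_unit[of k]] *[OF \<phi>_unit] by simp_all
qed

text \<open>A constant majorant for dominated convergence: two products, each of modulus at most
  \<open>2 * 2\<close>.\<close>

lemma norm_J_le: "cmod (J n k \<eta>) \<le> 8"
proof -
  have \<Psi>: "cmod (\<Psi> n k i) \<le> 2" for k i
  proof -
    have "cmod (\<phi> $ i) \<le> 1" "cmod (N k $ i) \<le> 1"
      using exhaust_2[of i] norm_N_le[of k] norm_\<phi>_le by auto
    hence "cmod (of_real (cos (n * \<omega> k)) * \<phi> $ i) \<le> 1 * 1" "cmod (of_real (sin (n * \<omega> k)) * N k $ i) \<le> 1 * 1"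
      unfolding norm_mult by (intro mult_mono; simp)+
    thus ?thesis unfolding \<Psi>_eq by (intro norm_triangle_le) simp
  qed
  have "cmod (cnj (\<Psi> n k i) * \<Psi> n (k + \<eta>) i) \<le> 2 * 2" for i
    unfolding norm_mult using \<Psi>[of k i] \<Psi>[of "k + \<eta>" i] by (intro mult_mono) auto
  hence "cmod (cnj (\<Psi> n k 1) * \<Psi> n (k + \<eta>) 1) + cmod (cnj (\<Psi> n k 2) * \<Psi> n (k + \<eta>) 2) \<le> 2 * 2 + 2 * 2"
    by (intro add_mono)
  thus ?thesis unfolding J_def by (intro norm_triangle_le) linarith
qed

lemma S_continuous: "isCont S k"
  unfolding S_def[abs_def] by (intro continuous_intros)

lemma N_continuous: "isCont (\<lambda>k. N k $ 1) k" "isCont (\<lambda>k. N k $ 2) k"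
proof -
  have "complex_of_real (S k) \<noteq> 0" using S_pos[of k] by simp
  thus "isCont (\<lambda>k. N k $ 1) k" "isCont (\<lambda>k. N k $ 2) k"
    unfolding N_def vector_2 cis_cartesian by (intro continuous_intros S_continuous; assumption)+
qed

lemma vel_continuous: "continuous_on T vel"
  by (rule DERIV_continuous_on[OF has_field_derivative_at_within[OF vel_deriv]])

text \<open>For \<open>t \<noteq> 0\<close> this is \<open>t\<close> times the difference quotient
  of \<omega> with increment \<open>t / n\<close>; \<open>t = 0\<close> is treated apart because
  that increment vanishes.\<close>

lemma phase_increment_tendsto:
  "(\<lambda>n. real n * \<omega> (k + t / real n) - real n * \<omega> k) \<longlonglongrightarrow> t * vel k"
proof (cases "t = 0")
  case False
  have "(\<lambda>n. t / real n) \<longlonglongrightarrow> 0" by (rule lim_const_over_n)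
  hence "filterlim (\<lambda>n. t / real n) (at 0) sequentially"
    using False by (auto simp: filterlim_at intro: eventually_mono[OF eventually_gt_at_top[of 0]])
  with \<omega>_deriv[of k, unfolded DERIV_def]
  have "(\<lambda>n. (\<omega> (k + t / real n) - \<omega> k) / (t / real n)) \<longlonglongrightarrow> vel k"
    by (rule filterlim_compose)
  hence "(\<lambda>n. t * ((\<omega> (k + t / real n) - \<omega> k) / (t / real n))) \<longlonglongrightarrow> t * vel k"
    by (rule tendsto_mult_left)
  thus ?thesis
    by (rule Lim_transform_eventually)
       (use False in \<open>auto intro!: eventually_mono[OF eventually_gt_at_top[of 0]] simp: field_simps\<close>)
qed simp

lemma J_tendsto:
  "(\<lambda>n. J n k (t / real n)) \<longlonglongrightarrow> of_real (cos (t * vel k)) + \<i> * g k * of_real (sin (t * vel k))"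
proof -
  have h: "(\<lambda>n. k + t / real n) \<longlonglongrightarrow> k"
    using tendsto_add[OF tendsto_const[of k] lim_const_over_n[of t]] by simp
  have N0: "(\<lambda>n. u * (N (k + t / real n) $ 1 - N k $ 1) + v * (N (k + t / real n) $ 2 - N k $ 2)) \<longlonglongrightarrow> 0" for u v
  proof -
    note N = isCont_tendsto_compose[OF N_continuous(1) h] isCont_tendsto_compose[OF N_continuous(2) h]
    have "(\<lambda>n. u * (N (k + t / real n) $ 1 - N k $ 1) + v * (N (k + t / real n) $ 2 - N k $ 2))
        \<longlonglongrightarrow> u * (N k $ 1 - N k $ 1) + v * (N k $ 2 - N k $ 2)"
      by (intro tendsto_intros N)
    thus ?thesis by simp
  qed
  \<comment> \<open>\<open>X\<close> and \<open>Y\<close> stand for sines and cosines of multiples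
    of \<omega>, which need not converge; their boundedness suffices.\<close>
  have err: "(\<lambda>n. of_real (X n * Y n) * (u * (N (k + t / real n) $ 1 - N k $ 1)
      + v * (N (k + t / real n) $ 2 - N k $ 2))) \<longlonglongrightarrow> 0"
    if "\<And>n. \<bar>X n\<bar> \<le> 1" "\<And>n. \<bar>Y n\<bar> \<le> 1" for X Y :: "nat \<Rightarrow> real" and u v
  proof (rule tendsto_norm_zero_cancel, rule tendsto_sandwich[OF _ _ tendsto_const tendsto_norm_zero[OF N0[of u v]]])
    have "\<bar>X n * Y n\<bar> \<le> 1" for n
      using mult_mono[OF that(1)[of n] that(2)[of n]] by (simp add: abs_mult)
    thus "\<forall>\<^sub>F n in sequentially. cmod (of_real (X n * Y n) * (u * (N (k + t / real n) $ 1 - N k $ 1)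
      + v * (N (k + t / real n) $ 2 - N k $ 2)))
      \<le> cmod (u * (N (k + t / real n) $ 1 - N k $ 1) + v * (N (k + t / real n) $ 2 - N k $ 2))"
      by (intro always_eventually allI) (simp add: norm_mult mult_left_le_one_le del: of_real_mult)
  qed auto
  have "(\<lambda>n. J n k (t / real n)) \<longlonglongrightarrow> of_real (cos (t * vel k)) + \<i> * g k * of_real (sin (t * vel k)) + 0 + 0"
    unfolding J_eq
    by (intro tendsto_add tendsto_mult tendsto_const tendsto_of_real tendsto_cos tendsto_sin
        phase_increment_tendsto err) auto
  thus ?thesis by simp
qed

text \<open>
  The \<open>\<mu>\<close> term of \<open>g\<close> is odd under \<open>k \<mapsto> pi - k\<close>, which fixes \<open>vel\<close>; folding the period \<open>[-pi/2, 3pi/2]\<close>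
  onto \<open>[-pi/2, pi/2]\<close> along this reflection therefore removes it.
\<close>

definition M where "M t k = complex_of_real (cos (t * vel k)) + \<i> * of_real (lam * vel k * sin (t * vel k))"

text \<open>Dominated convergence yields the integral of the limit \<open>L\<close>. The
  \<open>2 * pi\<close> of Parseval and the 2 from folding leave \<open>1 / pi\<close>.\<close>

lemma char_walk_tendsto:
  "(\<lambda>n. char (walk_measure A \<phi> n) t) \<longlonglongrightarrow> integral {- (pi / 2)..pi / 2} (M t) / pi"
proof -
  define L where "L k = complex_of_real (cos (t * vel k)) + \<i> * g k * of_real (sin (t * vel k))" for k
  define I where "I = {- (pi / 2)..- (pi / 2) + 2 * pi}"
  note J = char_walk_measure[of _ t "- (pi / 2)", folded I_def]
  have L_int: "L integrable_on I"
    and lim: "(\<lambda>n. integral I (\<lambda>k. J n k (t / real n))) \<longlonglongrightarrow> integral I L"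
    unfolding L_def
    by (rule dominated_convergence[where h = "\<lambda>_. 8" and f = "\<lambda>n k. J n k (t / real n)"];
        use J norm_J_le J_tendsto in \<open>auto simp: I_def intro: has_integral_integrable\<close>)+
  have "vel (pi - k) = vel k" "S (pi - k) = S k" for k
    by (simp_all add: vel_def S_def)
  hence sym: "L k + L (pi - k) = 2 * M t k" for k
    by (simp add: L_def M_def g_def algebra_simps)
  have ab: "L integrable_on {- (pi / 2)..pi / 2}" "L integrable_on {pi / 2..- (pi / 2) + 2 * pi}"
    by (rule integrable_subinterval_real[OF L_int[unfolded I_def]]; auto)+
  have refl: "((\<lambda>k. L (pi - k)) has_integral integral {pi / 2..- (pi / 2) + 2 * pi} L) {- (pi / 2)..pi / 2}"
    using has_integral_affinity[OF integrable_integral[OF ab(2), folded box_real], of "-1" pi]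
    by (simp add: image_affinity_atLeastAtMost algebra_simps)
  have "integral I L = integral {- (pi / 2)..pi / 2} L + integral {pi / 2..- (pi / 2) + 2 * pi} L"
    unfolding I_def
    by (rule Henstock_Kurzweil_Integration.integral_combine[symmetric, OF _ _ L_int[unfolded I_def]]) auto
  also have "\<dots> = integral {- (pi / 2)..pi / 2} (\<lambda>k. L k + L (pi - k))"
    using has_integral_add[OF integrable_integral[OF ab(1)] refl] by (simp add: integral_unique)
  also have "\<dots> = 2 * integral {- (pi / 2)..pi / 2} (M t)"
    unfolding sym by simp
  finally have "integral I L = 2 * integral {- (pi / 2)..pi / 2} (M t)" .
  hence "(\<lambda>n. 2 * pi * char (walk_measure A \<phi> n) t) \<longlonglongrightarrow> 2 * integral {- (pi / 2)..pi / 2} (M t)"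
    using lim integral_unique[OF J] by simp
  hence "(\<lambda>n. 2 * pi * char (walk_measure A \<phi> n) t / (2 * pi))
      \<longlonglongrightarrow> 2 * integral {- (pi / 2)..pi / 2} (M t) / (2 * pi)"
    by (intro tendsto_divide tendsto_const) auto
  thus ?thesis by simp
qed

text \<open>Up to the factor \<open>1 / pi\<close>, what the substitution \<open>y = vel k\<close>
  makes of the limit density times \<open>iexp (t * y)\<close>.\<close>

definition G where "G t k = (1 + lam * vel k) *\<^sub>R cis (t * vel k)"

lemma G_continuous: "continuous_on T (G t)"
  unfolding G_def by (intro continuous_intros vel_continuous)

text \<open>\<open>M t\<close> is the even part of \<open>G t\<close>, because \<open>vel\<close> is
  odd, and the interval is symmetric.\<close>

lemma integral_M: "integral {- (pi / 2)..pi / 2} (M t) = integral {- (pi / 2)..pi / 2} (G t)"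
proof -
  have G: "(G t has_integral integral {- (pi / 2)..pi / 2} (G t)) {- (pi / 2)..pi / 2}"
    by (intro integrable_integral integrable_continuous_real G_continuous)
  hence "((\<lambda>k. G t (- k)) has_integral integral {- (pi / 2)..pi / 2} (G t)) {- (pi / 2)..pi / 2}"
    using has_integral_reflect_lemma_real[OF G] by simp
  from has_integral_add[OF G this]
  have "((\<lambda>k. G t k + G t (- k)) has_integral 2 * integral {- (pi / 2)..pi / 2} (G t)) {- (pi / 2)..pi / 2}"
    by simp
  moreover have "G t k + G t (- k) = 2 * M t k" for k
  proof -
    have "vel (- k) = - vel k" by (simp add: vel_def S_def)
    thus ?thesis
      by (simp add: complex_eq_iff G_def M_def algebra_simps)
  qed
  ultimately have "((\<lambda>k. 2 * M t k) has_integral 2 * integral {- (pi / 2)..pi / 2} (G t)) {- (pi / 2)..pi / 2}"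
    by simp
  from integral_unique[OF this] show ?thesis by simp
qed

section \<open>The substitution \<open>y = vel k\<close>\<close>

lemma vel_strict_mono: "strict_mono_on {- (pi / 2)..pi / 2} vel"
proof (rule strict_mono_onI)
  fix k l assume kl: "k \<in> {- (pi / 2)..pi / 2}" "l \<in> {- (pi / 2)..pi / 2}" "k < l"
  show "vel k < vel l"
  proof (rule DERIV_pos_imp_increasing_open[OF kl(3)])
    fix x assume "k < x" "x < l"
    hence "0 < cos x" using kl by (intro cos_gt_zero_pi) auto
    hence "0 < r * s\<^sup>2 * cos x / (S x) ^ 3"
      using r_pos s_pos S_pos[of x] by simp
    thus "\<exists>y. (vel has_real_derivative y) (at x) \<and> 0 < y" using vel_deriv by blast
  qed (rule vel_continuous)
qed

text \<open>At the ends \<open>cos\<close> vanishes and \<open>S\<close> is 1, so \<open>vel\<close>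
  is \<open>-r\<close> and \<open>r\<close> there; this is the origin of the interval in the limit
  law.\<close>

lemma vel_image: "vel ` {- (pi / 2)<..<pi / 2} = {- r<..<r}"
proof -
  have ends: "vel (- (pi / 2)) = - r" "vel (pi / 2) = r"
    by (simp_all add: vel_def S_def)
  show ?thesis
  proof (intro equalityI subsetI)
    fix y assume "y \<in> vel ` {- (pi / 2)<..<pi / 2}"
    then obtain k where k: "- (pi / 2) < k" "k < pi / 2" and y: "y = vel k" by auto
    have "vel (- (pi / 2)) < vel k" "vel k < vel (pi / 2)"
      using k by (auto intro!: strict_mono_onD[OF vel_strict_mono])
    thus "y \<in> {- r<..<r}" by (simp add: ends y)
  next
    fix y assume y: "y \<in> {- r<..<r}"
    hence "\<exists>k. - (pi / 2) \<le> k \<and> k \<le> pi / 2 \<and> vel k = y"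
      by (intro IVT') (auto simp: ends vel_continuous)
    then obtain k where k: "- (pi / 2) \<le> k" "k \<le> pi / 2" "vel k = y" by blast
    hence "vel k \<noteq> vel (- (pi / 2))" "vel k \<noteq> vel (pi / 2)" using y by (auto simp: ends)
    hence "k \<noteq> - (pi / 2)" "k \<noteq> pi / 2" by blast+
    hence "k \<in> {- (pi / 2)<..<pi / 2}" using k by (simp only: greaterThanLessThan_iff less_le) simp
    thus "y \<in> vel ` {- (pi / 2)<..<pi / 2}" using k by blast
  qed
qed

text \<open>By \<open>vel_sq\<close> the denominator of the density cancels against the derivative
  of \<open>vel\<close>; \<open>cos k > 0\<close> resolves the square root.\<close>

lemma limit_density_vel:
  assumes "k \<in> {- (pi / 2)<..<pi / 2}"
  shows "r * s\<^sup>2 * cos k / (S k) ^ 3 * limit_density a b \<phi> (vel k) = (1 + lam * vel k) / pi"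
proof -
  have cos: "0 < cos k" using assms by (intro cos_gt_zero_pi) auto
  have "vel k \<in> {- r<..<r}" using assms vel_image by blast
  hence eq: "limit_density a b \<phi> (vel k)
      = s * (1 + lam * vel k) / (pi * (s\<^sup>2 / (S k)\<^sup>2) * (r * s * cos k / S k))"
    using cos r_pos s_pos S_pos[of k] unfolding limit_density_def r_def[symmetric] s_def[symmetric] lam_def[symmetric]
    by (simp add: vel_sq)
  show ?thesis unfolding eq using cos r_pos s_pos S_pos[of k]
    by (simp add: field_simps power2_eq_square power3_eq_cube)
qed

lemma limit_density_integral:
  "integrable lborel (\<lambda>y. limit_density a b \<phi> y *\<^sub>R iexp (t * y))"
  "(CLINT y|lborel. limit_density a b \<phi> y *\<^sub>R iexp (t * y)) = integral {- (pi / 2)..pi / 2} (G t) / pi"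
proof -
  define f where "f y = limit_density a b \<phi> y *\<^sub>R iexp (t * y)" for y
  define T where "T = {- (pi / 2)<..<pi / 2}"
  define v where "v k = r * s\<^sup>2 * cos k / (S k) ^ 3" for k
  have eq: "\<bar>v k\<bar> *\<^sub>R f (vel k) = (1 / pi) *\<^sub>R G t k" if "k \<in> T" for k
  proof -
    have "0 < cos k" using that by (intro cos_gt_zero_pi) (auto simp: T_def)
    hence "0 < v k" using r_pos s_pos S_pos[of k] by (simp add: v_def)
    moreover have "v k * limit_density a b \<phi> (vel k) = (1 + lam * vel k) / pi"
      unfolding v_def by (rule limit_density_vel) (use that in \<open>simp add: T_def\<close>)
    ultimately show ?thesis by (simp add: f_def G_def cis_conv_exp)
  qed
  \<comment> \<open>Integrability is obtained on the \<open>k\<close> side, where the integrand is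
    continuous on a compact interval; on the \<open>y\<close> side the denominator vanishes at the
    ends.\<close>
  have "(\<lambda>k. (1 / pi) *\<^sub>R G t k) absolutely_integrable_on {- (pi / 2)..pi / 2}"
    by (intro absolutely_integrable_continuous_real continuous_intros G_continuous)
  hence "(\<lambda>k. (1 / pi) *\<^sub>R G t k) absolutely_integrable_on T"
    by (rule set_integrable_subset) (auto simp: T_def)
  hence "(\<lambda>k. \<bar>v k\<bar> *\<^sub>R f (vel k)) absolutely_integrable_on T"
    by (rule absolutely_integrable_spike[where S = "{}"]) (auto simp: eq)
  moreover have "integral T (\<lambda>k. \<bar>v k\<bar> *\<^sub>R f (vel k)) = integral {- (pi / 2)..pi / 2} (G t) / pi"
  proof -
    have "integral T (\<lambda>k. \<bar>v k\<bar> *\<^sub>R f (vel k)) = integral T (\<lambda>k. (1 / pi) *\<^sub>R G t k)"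
      by (intro integral_cong) (rule eq)
    also have "\<dots> = (1 / pi) *\<^sub>R integral {- (pi / 2)..pi / 2} (G t)"
      unfolding T_def using integral_open_interval_real[of "- (pi/2)" "pi/2" "\<lambda>k. (1 / pi) *\<^sub>R G t k"] by simp
    finally show ?thesis by (simp add: scaleR_conv_of_real)
  qed
  moreover have "inj_on vel T"
    using strict_mono_on_imp_inj_on[OF vel_strict_mono] by (rule inj_on_subset) (auto simp: T_def)
  moreover have "(vel has_field_derivative v k) (at k within T)" for k
    unfolding v_def by (rule has_field_derivative_at_within[OF vel_deriv])
  ultimately have "f absolutely_integrable_on vel ` T \<and> integral (vel ` T) f = integral {- (pi / 2)..pi / 2} (G t) / pi"
    by (subst has_absolute_integral_change_of_variables_real[symmetric, of T vel v]) (auto simp: T_def)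
  hence f: "f absolutely_integrable_on {- r<..<r}" "integral {- r<..<r} f = integral {- (pi / 2)..pi / 2} (G t) / pi"
    unfolding T_def vel_image by auto
  \<comment> \<open>The indicator inside \<open>limit_density\<close> makes integrals over the
    interval and over the line agree.\<close>
  have ind: "(\<lambda>y. indicator {- r<..<r} y *\<^sub>R f y) = f"
    by (auto simp: f_def limit_density_def r_def indicator_def fun_eq_iff)
  \<comment> \<open>Borel measurability brings the result from \<open>lebesgue\<close> down to
    \<open>lborel\<close>.\<close>
  have [measurable]: "f \<in> borel_measurable borel"
    unfolding f_def limit_density_def by measurable
  show "integrable lborel f"
    using f(1) unfolding set_integrable_def ind by (simp add: integrable_completion)
  have "integral\<^sup>L lborel f = integral\<^sup>L lebesgue f"
    by (simp add: integral_completion)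
  also have "\<dots> = integral {- r<..<r} f"
    using set_lebesgue_integral_eq_integral(2)[OF f(1)] by (simp add: set_lebesgue_integral_def ind)
  finally show "integral\<^sup>L lborel f = integral {- (pi / 2)..pi / 2} (G t) / pi" using f(2) by simp
qed

section \<open>The limit law and Levy's theorem\<close>

abbreviation "limit_measure \<equiv> density lborel (\<lambda>y. ennreal (limit_density a b \<phi> y))"

lemma limit_density_measurable [measurable]: "limit_density a b \<phi> \<in> borel_measurable borel"
  unfolding limit_density_def[abs_def] by measurable

lemma limit_density_nonneg': "0 \<le> limit_density a b \<phi> y"
  by (rule limit_density_nonneg[OF unit a \<phi>])

lemma char_limit_measure: "char limit_measure t = integral {- (pi / 2)..pi / 2} (G t) / pi"
  unfolding char_def limit_density_integral(2)[symmetric]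
  by (rule integral_density) (auto simp: limit_density_nonneg')

text \<open>Total mass is the case \<open>t = 0\<close>: there \<open>integral_M\<close> replaces
  \<open>G 0\<close> by \<open>M 0\<close>, which is constantly 1, on an interval of length
  \<open>pi\<close>.\<close>

lemma real_distribution_limit_measure: "real_distribution limit_measure"
proof -
  have M0: "M 0 = (\<lambda>_. 1)" by (simp add: M_def fun_eq_iff)
  have eq: "(\<lambda>y. limit_density a b \<phi> y *\<^sub>R iexp (0 * y)) = (\<lambda>y. complex_of_real (limit_density a b \<phi> y))"
    by (simp add: scaleR_conv_of_real)
  have "(CLINT y|lborel. complex_of_real (limit_density a b \<phi> y)) = complex_of_real 1"
    using limit_density_integral(2)[of 0] unfolding eq integral_M[symmetric] M0
    by (simp add: scaleR_conv_of_real)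
  hence "(\<integral>y. limit_density a b \<phi> y \<partial>lborel) = 1"
    by (simp only: integral_complex_of_real of_real_eq_iff)
  moreover have "integrable lborel (limit_density a b \<phi>)"
    using limit_density_integral(1)[of 0] unfolding eq by (simp only: complex_of_real_integrable_eq)
  ultimately have "(\<integral>\<^sup>+y. ennreal (limit_density a b \<phi> y) \<partial>lborel) = 1"
    by (simp add: nn_integral_eq_integral limit_density_nonneg')
  hence "prob_space limit_measure"
    by (intro prob_spaceI) (simp add: emeasure_density)
  thus ?thesis by (simp add: real_distribution_def real_distribution_axioms_def)
qed

lemma walk_measure_weak_conv: "weak_conv_m (\<lambda>n. walk_measure A \<phi> n) limit_measure"
  using char_walk_tendsto integral_M char_limit_measure
  by (intro levy_continuity real_distribution_walk_measure[OF A unit \<phi>] real_distribution_limit_measure) simp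

end

theorem theorem1:
  fixes a b :: complex and A :: "complex^2^2" and \<phi> :: "complex^2"
  assumes "(cmod a)\<^sup>2 + (cmod b)\<^sup>2 = 1"
    and "A = vector [vector [a, b], vector [- cnj b, cnj a]]"
    and "a \<noteq> 0" and "b \<noteq> 0"
    and "norm \<phi> = 1"
  shows "weakly_converges (\<lambda>n. walk_measure A \<phi> n)
           (density lborel (\<lambda>y. ennreal (limit_density a b \<phi> y)))"
proof -
  interpret coined_walk a b A \<phi> using assms by unfold_locales
  show ?thesis unfolding weakly_converges_def
  proof (intro allI impI)
    fix f :: "real \<Rightarrow> real" assume f: "continuous_on UNIV f" "bounded (range f)"
    obtain B where "\<And>x. norm (f x) \<le> B" using f(2) by (auto simp: bounded_iff)
    moreover have "isCont f x" for x using f(1) by (simp add: continuous_on_eq_continuous_at)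
    \<comment> \<open>Passage from distribution functions to bounded continuous test
      functions.\<close>
    ultimately show "(\<lambda>n. integral\<^sup>L (walk_measure A \<phi> n) f) \<longlonglongrightarrow> integral\<^sup>L limit_measure f"
      using walk_measure_weak_conv real_distribution_walk_measure[OF A unit \<phi>] real_distribution_limit_measure
      by (intro weak_conv_imp_integral_bdd_continuous_conv)
  qed
qed

end
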